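(* Let $\tau\in \mathcal{H}_g$ be a reduced matrix, and let $v\in \mathbb{R}^g$. Let $R\in \mathbb{R}_{\geq 0}$ be such that $R^2 = \mathrm{Dist}_\tau(v, \mathbb{Z}^g)^2 + \delta^2$ with $\delta \in \mathbb{R}_{\geq 0}$. Then \[\sum_{n\in\mathbb{Z}^g\setminus\mathcal{E}(v,R,\tau)}\exp\big(-\|n-v\|_\tau^2\big) \leq B(g) \max\{2,\delta\}^{g-1} \exp(-R^2),\] where $B(g) = 2^{10(1 + g\log g)}$. In particular, for every $z\in \mathbb{C}^g$ and all $a,b\in\{0,1\}^g$, writing $v=-\operatorname{Im}(\tau)^{-1}\operatorname{Im}(z)$, we have \[\big|\widetilde{\theta}_{a,b}(z,\tau)\big| \leq B(g) \exp\big(-\mathrm{Dist}_\tau(v,\mathbb{Z}^g + \tfrac a2)^2\big).\]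
   Context: $\mathcal{H}_g$: symmetric complex $g\times g$ matrices with positive definite imaginary part. $\mathrm{e}(x)=\exp(\pi ix)$; $\theta_{a,b}(z,\tau)=\sum_{n\in\mathbb{Z}^g+\frac a2}\mathrm{e}(n^T\tau n+2n^T(z+\tfrac b2))$; with $y=\operatorname{Im} z$, $Y=\operatorname{Im}\tau$, $\widetilde\theta_{a,b}(z,\tau)=\exp(-\pi y^TY^{-1}y)\theta_{a,b}(z,\tau)$. For $x\in\mathbb{R}^g$, $\|x\|_\tau=\sqrt{\pi x^TYx}$; $\mathrm{Dist}_\tau$ is the associated distance between points and sets; $\mathcal{E}(v,R,\tau)=\{x\in\mathbb{R}^g:\|x-v\|_\tau<R\}$. $\tau$ is reduced if $\operatorname{Im}(\tau)$ is reciprocal-HKZ reduced (the Gram matrix $P\operatorname{Im}(\tau)^{-1}P$, $P$ the coordinate-reversing permutation matrix, is Hermite–Korkine–Zolotarev reduced) and $n^T\operatorname{Im}(\tau)n\ge\sqrt3/2$ for all nonzero $n\in\mathbb{Z}^g$. *)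

theory Defs
  imports
    "HOL-Analysis.Infinite_Sum"
    "Jordan_Normal_Form.Gram_Schmidt"
    "Jordan_Normal_Form.Gauss_Jordan_Elimination"
begin

text \<open>Matrices and vectors have explicit dimension \<open>g\<close> and indices in \<open>{0..<g}\<close>.
  Integer vectors are kept as real vectors with entries in \<open>\<int>\<close>.\<close>

definition int_vecs :: "nat \<Rightarrow> real vec set" where
  "int_vecs g = {n \<in> carrier_vec g. \<forall>i<g. n $ i \<in> \<int>}"

text \<open>The translate of the integer lattice by \<open>a/2\<close>.\<close>

definition half_translate :: "real vec \<Rightarrow> real vec set" where
  "half_translate a = (\<lambda>n. n + (1/2) \<cdot>\<^sub>v a) ` int_vecs (dim_vec a)"

definition zero_one_vecs :: "nat \<Rightarrow> real vec set" where
  "zero_one_vecs g = {a \<in> carrier_vec g. \<forall>i<g. a $ i \<in> {0, 1}}"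

subsection \<open>The Siegel upper half space\<close>

definition pos_def :: "real mat \<Rightarrow> bool" where
  "pos_def Y \<longleftrightarrow> (\<forall>x \<in> carrier_vec (dim_row Y). x \<noteq> 0\<^sub>v (dim_row Y) \<longrightarrow> scalar_prod x (Y *\<^sub>v x) > 0)"

definition Im_mat :: "complex mat \<Rightarrow> real mat" where
  "Im_mat = map_mat Im"

definition siegel :: "nat \<Rightarrow> complex mat set" where
  "siegel g = {\<tau> \<in> carrier_mat g g. \<tau>\<^sup>T = \<tau> \<and> pos_def (Im_mat \<tau>)}"

text \<open>Only meaningful for invertible matrices; it is applied to positive definite ones.\<close>

definition inv_mat :: "real mat \<Rightarrow> real mat" where
  "inv_mat Y = the (mat_inverse Y)"

subsection \<open>Theta functions\<close>

text \<open>Note the factor \<open>\<pi>\<i>\<close>, not \<open>2\<pi>\<i>\<close>.\<close>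

definition e_pi :: "complex \<Rightarrow> complex" where
  "e_pi x = exp (complex_of_real pi * \<i> * x)"

definition theta :: "real vec \<Rightarrow> real vec \<Rightarrow> complex vec \<Rightarrow> complex mat \<Rightarrow> complex" where
  "theta a b z \<tau> = (\<Sum>\<^sub>\<infinity>n \<in> half_translate a.
     let n' = map_vec complex_of_real n; b' = map_vec complex_of_real b in
     e_pi (scalar_prod n' (\<tau> *\<^sub>v n') + 2 * scalar_prod n' (z + (1/2) \<cdot>\<^sub>v b')))"

definition theta_tilde :: "real vec \<Rightarrow> real vec \<Rightarrow> complex vec \<Rightarrow> complex mat \<Rightarrow> complex" where
  "theta_tilde a b z \<tau> =
     (let y = map_vec Im z in
      complex_of_real (exp (- pi * scalar_prod y (inv_mat (Im_mat \<tau>) *\<^sub>v y))) * theta a b z \<tau>)"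

subsection \<open>The metric attached to \<open>\<tau>\<close>\<close>

definition norm_tau :: "complex mat \<Rightarrow> real vec \<Rightarrow> real" where
  "norm_tau \<tau> x = sqrt (pi * scalar_prod x (Im_mat \<tau> *\<^sub>v x))"

definition Dist_tau :: "complex mat \<Rightarrow> real vec \<Rightarrow> real vec set \<Rightarrow> real" where
  "Dist_tau \<tau> v S = (INF x\<in>S. norm_tau \<tau> (v - x))"

definition ellipsoid :: "real vec \<Rightarrow> real \<Rightarrow> complex mat \<Rightarrow> real vec set" where
  "ellipsoid v R \<tau> = {x \<in> carrier_vec (dim_row \<tau>). norm_tau \<tau> (x - v) < R}"

subsection \<open>Hermite--Korkine--Zolotarev reduction\<close>

text \<open>The columns of \<open>B\<close> are the basis vectors \<open>b\<^sub>0, \<dots>, b\<^sub>g\<^sub>-\<^sub>1\<close>, and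
  \<open>gso B i\<close> is the \<open>i\<close>-th (unnormalised) Gram--Schmidt vector.\<close>

definition gso :: "real mat \<Rightarrow> nat \<Rightarrow> real vec" where
  "gso B i = gram_schmidt (dim_row B) (cols B) ! i"

text \<open>Orthogonal projection onto the complement of the span of \<open>b\<^sub>0, \<dots>, b\<^sub>i\<^sub>-\<^sub>1\<close>:
  the library function \<^const>\<open>adjuster\<close> returns minus the sum of the projections of its
  argument to the given orthogonal vectors.\<close>

definition gso_proj :: "real mat \<Rightarrow> nat \<Rightarrow> real vec \<Rightarrow> real vec" where
  "gso_proj B i x = adjuster (dim_row B) x (map (gso B) [0..<i]) + x"

definition gso_coeff :: "real mat \<Rightarrow> nat \<Rightarrow> nat \<Rightarrow> real" where
  "gso_coeff B i j = scalar_prod (col B i) (gso B j) / scalar_prod (gso B j) (gso B j)"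

text \<open>A basis is HKZ reduced if it is size reduced and, for each \<open>i\<close>, its \<open>i\<close>-th
  Gram--Schmidt vector is a shortest nonzero vector of the projection of the lattice to the
  complement of the previous basis vectors.\<close>

definition HKZ_reduced_basis :: "nat \<Rightarrow> real mat \<Rightarrow> bool" where
  "HKZ_reduced_basis g B \<longleftrightarrow>
     B \<in> carrier_mat g g \<and> det B \<noteq> 0 \<and>
     (\<forall>i<g. \<forall>j<i. \<bar>gso_coeff B i j\<bar> \<le> 1/2) \<and>
     (\<forall>i<g. \<forall>n \<in> int_vecs g.
        let x = gso_proj B i (B *\<^sub>v n) in
        x \<noteq> 0\<^sub>v g \<longrightarrow> scalar_prod (gso B i) (gso B i) \<le> scalar_prod x x)"

text \<open>The choice of \<open>B\<close> is irrelevant: two bases with the same Gram matrix differ by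
  an isometry.\<close>

definition HKZ_reduced_gram :: "nat \<Rightarrow> real mat \<Rightarrow> bool" where
  "HKZ_reduced_gram g G \<longleftrightarrow> (\<exists>B. HKZ_reduced_basis g B \<and> G = B\<^sup>T * B)"

definition reversal_mat :: "nat \<Rightarrow> real mat" where
  "reversal_mat g = mat g g (\<lambda>(i, j). if i + j + 1 = g then 1 else 0)"

definition reciprocal_HKZ_reduced :: "nat \<Rightarrow> real mat \<Rightarrow> bool" where
  "reciprocal_HKZ_reduced g Y \<longleftrightarrow>
     HKZ_reduced_gram g (reversal_mat g * inv_mat Y * reversal_mat g)"

definition reduced :: "nat \<Rightarrow> complex mat \<Rightarrow> bool" where
  "reduced g \<tau> \<longleftrightarrow>
     reciprocal_HKZ_reduced g (Im_mat \<tau>) \<and>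
     (\<forall>n \<in> int_vecs g. n \<noteq> 0\<^sub>v g \<longrightarrow> scalar_prod n (Im_mat \<tau> *\<^sub>v n) \<ge> sqrt 3 / 2)"

text \<open>The logarithm is the natural one.\<close>

definition B_bound :: "nat \<Rightarrow> real" where
  "B_bound g = 2 powr (10 * (1 + real g * ln (real g)))"

end

theory Submission
  imports Defs
begin

text \<open>Nonzero integer vectors have length at least 1. If \<open>n\<close> and \<open>n + 2m w\<close> both satisfy
  \<open>\<parallel>x - v\<parallel>\<^sup>2 \<le> D\<^sup>2 + E\<close>, where \<open>D\<close> is the distance from \<open>v\<close> to the lattice, then their
  midpoint \<open>n + m w\<close> is again a lattice point, hence not closer to \<open>v\<close> than \<open>D\<close>; the parallelogram law gives \<open>m\<^sup>2 \<parallel>w\<parallel>\<^sup>2 \<le> E\<close>. So for large \<open>m\<close> such points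
  are distinct modulo \<open>2m\<close>, and there are at most \<open>(2m)\<^sup>g\<close> of them. To gain one power of
  \<open>\<delta>\<close>, slice the lattice into lines parallel to a shortest vector: each line contributes
  \<open>O(exp (-R\<^sup>2))\<close>, and the lines meeting a given ball are counted through the many
  lattice points they contain in a slightly larger ball.\<close>

section \<open>Elementary bounds for sums of exponentials\<close>

lemma sum_geometric_le:
  fixes x :: real
  assumes "finite F" "0 \<le> x" "x < 1"
  shows "(\<Sum>k\<in>F. x ^ k) \<le> 1 / (1 - x)"
proof -
  have "(\<Sum>k\<in>F. x ^ k) \<le> (\<Sum>k. x ^ k)"
    by (rule sum_le_suminf) (use assms in \<open>auto intro: summable_geometric\<close>)
  then show ?thesis using assms by (simp add: suminf_geometric)
qed

text \<open>Past the least index of \<open>F\<close> the terms decay at least like a geometric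
  series of ratio \<open>exp (- 1)\<close>, bounded here by 1/2. The defect \<open>- 1\<close> in
  the growth condition allows for two equal consecutive values, which do occur on a lattice line; it
  costs a factor \<open>exp 1\<close>, at most 3. Hence 6 = 3 * 2.\<close>

lemma sum_exp_minus_le:
  fixes f :: "nat \<Rightarrow> real"
  assumes F: "finite F" and A: "\<And>i. i \<in> F \<Longrightarrow> A \<le> f i"
    and incr: "\<And>i d. f i + real d - 1 \<le> f (i + d)"
  shows "(\<Sum>i\<in>F. exp (- f i)) \<le> 6 * exp (- A)"
proof (cases "F = {}")
  case False
  define a where "a = Min F"
  have aF: "a \<in> F" and a: "\<And>i. i \<in> F \<Longrightarrow> a \<le> i"
    using F False by (auto simp: a_def)
  have e2: "exp (- 1 :: real) \<le> 1 / 2"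
    using exp_ge_add_one_self[of 1] by (simp add: exp_minus field_simps)
  have "(\<Sum>i\<in>F. exp (- f i)) \<le> (\<Sum>i\<in>F. exp (- A) * 3 * (1 / 2) ^ (i - a))"
  proof (rule sum_mono)
    fix i assume i: "i \<in> F"
    have "A + real (i - a) - 1 \<le> f i"
      using incr[of a "i - a"] A[OF aF] a[OF i] by simp
    then have "exp (- f i) \<le> exp (- A + 1 + real (i - a) * (- 1))" by simp
    also have "\<dots> = exp (- A) * exp 1 * exp (- 1) ^ (i - a)"
      by (simp only: exp_add exp_of_nat_mult)
    also have "\<dots> \<le> exp (- A) * 3 * (1 / 2) ^ (i - a)"
      by (intro mult_mono power_mono e2 exp_le) auto
    finally show "exp (- f i) \<le> exp (- A) * 3 * (1 / 2) ^ (i - a)" .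
  qed
  also have "\<dots> = exp (- A) * 3 * (\<Sum>k\<in>(\<lambda>i. i - a) ` F. (1 / 2) ^ k)"
  proof -
    have "inj_on (\<lambda>i. i - a) F"
      using a by (intro inj_onI) (metis le_add_diff_inverse2)
    then show ?thesis by (simp add: sum.reindex sum_distrib_left)
  qed
  also have "\<dots> \<le> exp (- A) * 3 * 2"
    using sum_geometric_le[of "(\<lambda>i. i - a) ` F" "1 / 2"] F by (intro mult_left_mono) auto
  finally show ?thesis by simp
qed simp

section \<open>Integer vectors and congruences\<close>

lemma int_vecs_add_smult:
  assumes "n \<in> int_vecs g" "w \<in> int_vecs g"
  shows "n + of_int k \<cdot>\<^sub>v w \<in> int_vecs g"
  using assms by (auto simp: int_vecs_def)

lemma zero_int_vecs: "0\<^sub>v g \<in> int_vecs g"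
  by (auto simp: int_vecs_def)

text \<open>The floors merely read integral real entries as integers, so that \<open>mod\<close> and
  \<open>div\<close> apply; \<open>w\<close> is the entrywise quotient of the difference.\<close>

lemma int_vecs_cong_imp_diff_multiple:
  assumes n: "n \<in> int_vecs g" and m: "m \<in> int_vecs g" and N: "(N::int) \<noteq> 0"
    and cong: "\<And>i. i < g \<Longrightarrow> \<lfloor>n $ i\<rfloor> mod N = \<lfloor>m $ i\<rfloor> mod N"
  obtains w where "w \<in> int_vecs g" "m = n + of_int N \<cdot>\<^sub>v w"
proof
  define w :: "real vec" where "w = vec g (\<lambda>i. of_int ((\<lfloor>m $ i\<rfloor> - \<lfloor>n $ i\<rfloor>) div N))"
  show "w \<in> int_vecs g" by (auto simp: w_def int_vecs_def)
  have "m $ i = n $ i + of_int N * w $ i" if i: "i < g" for i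
  proof -
    have "N dvd \<lfloor>m $ i\<rfloor> - \<lfloor>n $ i\<rfloor>"
      using cong[OF i] by (metis mod_eq_dvd_iff)
    then have "N * ((\<lfloor>m $ i\<rfloor> - \<lfloor>n $ i\<rfloor>) div N) = \<lfloor>m $ i\<rfloor> - \<lfloor>n $ i\<rfloor>" by simp
    then have "of_int N * w $ i = of_int \<lfloor>m $ i\<rfloor> - (of_int \<lfloor>n $ i\<rfloor> :: real)"
      using i by (simp add: w_def flip: of_int_mult of_int_diff)
    moreover have "of_int \<lfloor>m $ i\<rfloor> = m $ i" "of_int \<lfloor>n $ i\<rfloor> = n $ i"
      using n m i by (auto simp: int_vecs_def)
    ultimately show ?thesis by simp
  qed
  then show "m = n + of_int N \<cdot>\<^sub>v w"
    using n m by (intro eq_vecI) (auto simp: int_vecs_def w_def)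
qed

section \<open>Lattice points in sublevel sets of a quadratic function\<close>

text \<open>In the application \<open>q n = \<parallel>n - v\<parallel>\<^sup>2\<close>, \<open>h w = \<parallel>w\<parallel>\<^sup>2\<close>, \<open>\<beta>\<close> is the cross term, and
  \<open>D\<close> is the squared distance from \<open>v\<close> to the lattice.\<close>

locale lattice_quadratic =
  fixes g :: nat and q h :: "real vec \<Rightarrow> real" and \<beta> :: "real vec \<Rightarrow> real vec \<Rightarrow> real"
    and D :: real
  assumes g_pos: "0 < g"
    and expand: "\<And>n w k. n \<in> int_vecs g \<Longrightarrow> w \<in> int_vecs g \<Longrightarrow>
      q (n + of_int k \<cdot>\<^sub>v w) = q n + of_int k * \<beta> n w + (of_int k)\<^sup>2 * h w"
    and h_ge_1: "\<And>w. w \<in> int_vecs g \<Longrightarrow> w \<noteq> 0\<^sub>v g \<Longrightarrow> 1 \<le> h w"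
    and q_ge: "\<And>n. n \<in> int_vecs g \<Longrightarrow> D \<le> q n"
begin

text \<open>Reduction modulo \<open>2 * m\<close> is injective on \<open>S\<close>, so the number of
  residue vectors bounds the cardinality.\<close>

lemma card_sublevel_le:
  fixes m :: nat
  assumes S: "\<And>n. n \<in> S \<Longrightarrow> n \<in> int_vecs g \<and> q n \<le> D + E"
    and m: "\<And>w. w \<in> int_vecs g \<Longrightarrow> w \<noteq> 0\<^sub>v g \<Longrightarrow> E < (real m)\<^sup>2 * h w"
    and m0: "0 < m"
  shows "finite S \<and> card S \<le> (2 * m) ^ g"
proof -
  define N where "N = 2 * int m"
  define c where "c n = restrict (\<lambda>i. \<lfloor>n $ i\<rfloor> mod N) {..<g}" for n :: "real vec"
  have inj: "inj_on c S"
  proof (rule inj_onI)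
    fix n n' assume n: "n \<in> S" and n': "n' \<in> S" and eq: "c n = c n'"
    have "\<lfloor>n $ i\<rfloor> mod N = \<lfloor>n' $ i\<rfloor> mod N" if "i < g" for i
      using fun_cong[OF eq, of i] that by (simp add: c_def)
    then obtain w where w: "w \<in> int_vecs g" and n'w: "n' = n + of_int N \<cdot>\<^sub>v w"
      using int_vecs_cong_imp_diff_multiple[of n g n' N] S[OF n] S[OF n'] m0
      by (auto simp: N_def)
    have nZ: "n \<in> int_vecs g" using S[OF n] by simp
    \<comment> \<open>The midpoint of \<open>n\<close> and \<open>n'\<close> is integral because
      their difference is divisible by \<open>2 * m\<close>.\<close>
    have "D \<le> q (n + of_int (int m) \<cdot>\<^sub>v w)"
      by (intro q_ge int_vecs_add_smult nZ w)
    then have mid: "D \<le> q n + real m * \<beta> n w + (real m)\<^sup>2 * h w"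
      using expand[OF nZ w, of "int m"] by simp
    have "q n' = q n + 2 * (real m * \<beta> n w) + 4 * ((real m)\<^sup>2 * h w)"
      using expand[OF nZ w, of N] n'w by (simp add: N_def power_mult_distrib)
    \<comment> \<open>Parallelogram law: \<open>q n + q n'\<close> minus twice the value at the
      midpoint is \<open>2 * m^2 * h w\<close>, and it is at most
      \<open>2 * (D + E) - 2 * D\<close>.\<close>
    with mid S[OF n] S[OF n'] have "(real m)\<^sup>2 * h w \<le> E" by linarith
    with m[OF w] have "w = 0\<^sub>v g" by fastforce
    with n'w nZ show "n = n'" by (auto simp: int_vecs_def)
  qed
  have sub: "c ` S \<subseteq> {..<g} \<rightarrow>\<^sub>E {0..<N}"
    using m0 by (auto simp: c_def N_def split: if_splits)
  have fin: "finite ({..<g} \<rightarrow>\<^sub>E {0..<N})" by (intro finite_PiE) auto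
  have "card S = card (c ` S)" using inj by (simp add: card_image)
  also have "\<dots> \<le> card ({..<g} \<rightarrow>\<^sub>E {0..<N})" using fin sub by (rule card_mono)
  also have "\<dots> = (2 * m) ^ g" by (simp add: card_PiE N_def nat_mult_distrib)
  finally show ?thesis
    using finite_subset[OF sub fin] inj by (auto dest: finite_imageD)
qed

lemma finite_sublevel: "finite {n \<in> int_vecs g. q n \<le> r}"
proof -
  define m where "m = nat \<lceil>\<bar>r - D\<bar>\<rceil> + 1"
  have "r - D < real m" unfolding m_def by linarith
  also have m1: "real m \<le> (real m)\<^sup>2" by (rule self_le_power) (auto simp: m_def)
  finally have *: "r - D < (real m)\<^sup>2" .
  have "r - D < (real m)\<^sup>2 * h w" if "w \<in> int_vecs g" "w \<noteq> 0\<^sub>v g" for w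
    using * mult_left_mono[OF h_ge_1[OF that], of "(real m)\<^sup>2"] by simp
  then show ?thesis
    using card_sublevel_le[of "{n \<in> int_vecs g. q n \<le> r}" "r - D" m] by (auto simp: m_def)
qed

text \<open>A sublevel set of \<open>h\<close> lies in a sublevel set of \<open>q\<close>, hence is
  finite: \<open>q u + q (- u) = 2 * q 0 + 2 * h u\<close>, and \<open>q (- u)\<close> is at least
  \<open>D\<close>. The all-ones vector \<open>e\<close> only serves as some nonzero vector to start
  from.\<close>

lemma obtain_shortest:
  obtains w where "w \<in> int_vecs g" "w \<noteq> 0\<^sub>v g"
    "\<And>u. u \<in> int_vecs g \<Longrightarrow> u \<noteq> 0\<^sub>v g \<Longrightarrow> h w \<le> h u"
proof -
  define e :: "real vec" where "e = vec g (\<lambda>i. 1)"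
  have e: "e \<in> int_vecs g" "e \<noteq> 0\<^sub>v g"
    using g_pos by (auto simp: e_def int_vecs_def vec_eq_iff)
  define T where "T = {u \<in> int_vecs g. u \<noteq> 0\<^sub>v g \<and> h u \<le> h e}"
  have "T \<subseteq> {n \<in> int_vecs g. q n \<le> 2 * q (0\<^sub>v g) + 2 * h e - D}"
  proof
    fix u assume u: "u \<in> T"
    then have uZ: "u \<in> int_vecs g" by (simp add: T_def)
    have "D \<le> q (0\<^sub>v g + of_int (- 1) \<cdot>\<^sub>v u)"
      by (intro q_ge int_vecs_add_smult zero_int_vecs uZ)
    moreover have "q u = q (0\<^sub>v g + of_int 1 \<cdot>\<^sub>v u)"
      using uZ by (simp add: int_vecs_def)
    ultimately show "u \<in> {n \<in> int_vecs g. q n \<le> 2 * q (0\<^sub>v g) + 2 * h e - D}"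
      using expand[OF zero_int_vecs uZ, of 1] expand[OF zero_int_vecs uZ, of "- 1"] u
      by (auto simp: T_def)
  qed
  then have fin: "finite T" using finite_sublevel by (rule finite_subset)
  have eT: "e \<in> T" using e by (simp add: T_def)
  define w where "w = arg_min_on h T"
  have w: "w \<in> T" "\<And>u. u \<in> T \<Longrightarrow> h w \<le> h u"
    using arg_min_if_finite(1)[OF fin] arg_min_least[OF fin] eT by (auto simp: w_def)
  have "h w \<le> h u" if "u \<in> int_vecs g" "u \<noteq> 0\<^sub>v g" for u
    using w(2)[of u] w(2)[OF eT] that by (cases "h u \<le> h e") (auto simp: T_def)
  with w(1) that show thesis by (auto simp: T_def)
qed

end

section \<open>Slicing the lattice into lines parallel to a shortest vector\<close>

text \<open>On a line parallel to \<open>w\<close>, \<open>q\<close> is \<open>h w * t\<^sup>2\<close> plus a constant, in terms of the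
  parameter \<open>t\<close> below; \<open>M\<close> contains the point of each line at which \<open>q\<close> is least.\<close>

locale lattice_lines = lattice_quadratic +
  fixes w :: "real vec"
  assumes w_int: "w \<in> int_vecs g" and w_nz: "w \<noteq> 0\<^sub>v g"
    and w_shortest: "\<And>u. u \<in> int_vecs g \<Longrightarrow> u \<noteq> 0\<^sub>v g \<Longrightarrow> h w \<le> h u"
begin

definition t :: "real vec \<Rightarrow> real" where
  "t n = \<beta> n w / (2 * h w)"

text \<open>The interval is half-open so that each line has exactly one representative, even when
  two of its points share the least value of \<open>q\<close>.\<close>

definition M :: "real vec set" where
  "M = {p \<in> int_vecs g. - 1 / 2 \<le> t p \<and> t p < 1 / 2}"

definition shift :: "real vec \<Rightarrow> int \<Rightarrow> real vec" where
  "shift n k = n + of_int k \<cdot>\<^sub>v w"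

definition line_min :: "real vec \<Rightarrow> real vec" where
  "line_min n = shift n (- \<lfloor>t n + 1 / 2\<rfloor>)"

lemma hw: "1 \<le> h w"
  using h_ge_1 w_int w_nz by blast

lemma shift_int: "n \<in> int_vecs g \<Longrightarrow> shift n k \<in> int_vecs g"
  unfolding shift_def by (intro int_vecs_add_smult w_int)

lemma shift_shift: "n \<in> int_vecs g \<Longrightarrow> shift (shift n k) l = shift n (k + l)"
  using w_int by (intro eq_vecI) (auto simp: int_vecs_def shift_def algebra_simps)

lemma shift_0: "n \<in> int_vecs g \<Longrightarrow> shift n 0 = n"
  using w_int by (intro eq_vecI) (auto simp: int_vecs_def shift_def)

lemma q_shift:
  assumes "n \<in> int_vecs g"
  shows "q (shift n k) = q n + h w * ((of_int k)\<^sup>2 + 2 * of_int k * t n)"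
  using expand[OF assms w_int, of k] hw by (simp add: shift_def t_def field_simps)

text \<open>Since \<beta> is known only through \<open>expand\<close>, the law is extracted from
  \<open>q\<close>: the value at \<open>shift n (k + 1)\<close> is computed directly and through
  \<open>shift n k\<close>, and the two results are compared.\<close>

lemma t_shift:
  assumes n: "n \<in> int_vecs g"
  shows "t (shift n k) = t n + of_int k"
proof -
  have "h w * (1 + 2 * t (shift n k) + (of_int k)\<^sup>2 + 2 * of_int k * t n)
      = h w * ((of_int (k + 1))\<^sup>2 + 2 * of_int (k + 1) * t n)"
    using q_shift[OF shift_int[OF n], of k 1] q_shift[OF n, of "k + 1"] q_shift[OF n, of k]
      shift_shift[OF n, of k 1]
    by (simp add: algebra_simps)
  then have "h w * (t (shift n k)) = h w * (t n + of_int k)"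
    by (simp add: power2_eq_square algebra_simps)
  then show ?thesis using hw by simp
qed

lemma line_min_M: "n \<in> int_vecs g \<Longrightarrow> line_min n \<in> M"
  unfolding M_def line_min_def by (auto simp: shift_int t_shift) linarith+

lemma shift_line_min: "n \<in> int_vecs g \<Longrightarrow> shift (line_min n) \<lfloor>t n + 1 / 2\<rfloor> = n"
  unfolding line_min_def by (simp add: shift_shift shift_0)

text \<open>Each representative \<open>p\<close> yields \<open>J\<close> lattice points
  \<open>shift p j\<close> with \<open>j < J\<close>, all different and all in a sublevel set only
  slightly larger. That set has at most \<open>(4 * J) ^ g\<close> points, and division by
  \<open>J\<close> saves one power.\<close>

lemma card_lines_le:
  assumes S: "finite S" "S \<subseteq> M" "\<And>p. p \<in> S \<Longrightarrow> q p \<le> D + E" and E: "0 \<le> E"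
  shows "real (card S) \<le> 4 ^ g * (sqrt E + 1) ^ (g - 1)"
proof -
  define J where "J = nat \<lfloor>sqrt E\<rfloor> + 1"
  have J1: "1 \<le> real J" by (simp add: J_def)
  have J: "sqrt E \<le> real J" "real J \<le> sqrt E + 1"
    using E by (auto simp: J_def) linarith+
  have "E \<le> (real J)\<^sup>2" using J(1) E by (metis sqrt_le_D)
  also have "\<dots> \<le> (real J)\<^sup>2 * h w" using mult_left_mono[OF hw, of "(real J)\<^sup>2"] by simp
  finally have EJ: "E \<le> (real J)\<^sup>2 * h w" .
  define f where "f = (\<lambda>(p, j). shift p (int j))"
  have inj: "inj_on f (S \<times> {..<J})"
  proof (rule inj_onI, clarsimp simp: f_def)
    fix p j p' j' assume p: "p \<in> S" and p': "p' \<in> S" and eq: "shift p (int j) = shift p' (int j')"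
    have pM: "p \<in> M" "p' \<in> M" using p p' S by auto
    then have pZ: "p \<in> int_vecs g" "p' \<in> int_vecs g" by (auto simp: M_def)
    have "t p + real j = t p' + real j'"
      using arg_cong[OF eq, of t] pZ by (simp add: t_shift)
    \<comment> \<open>Both \<open>t p\<close> and \<open>t p'\<close> lie in a half-open interval of
      length 1.\<close>
    with pM have "\<bar>real j - real j'\<bar> < 1" by (auto simp: M_def)
    then have jj: "j = j'" by linarith
    have "shift (shift p (int j)) (- int j) = shift (shift p' (int j')) (- int j')"
      using eq jj by simp
    then show "p = p' \<and> j = j'" using jj pZ by (simp add: shift_shift shift_0)
  qed
  \<comment> \<open>The counting lemma is applied with \<open>m = 2 * J\<close>. Its hypothesis
    holds because \<open>w\<close> is shortest: \<open>2 * J^2 * h w < 4 * J^2 * h u\<close> for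
    every nonzero \<open>u\<close>.\<close>
  have "finite (f ` (S \<times> {..<J})) \<and> card (f ` (S \<times> {..<J})) \<le> (2 * (2 * J)) ^ g"
  proof (rule card_sublevel_le)
    fix n assume "n \<in> f ` (S \<times> {..<J})"
    then obtain p j where p: "p \<in> S" and j: "j < J" and n: "n = shift p (int j)"
      by (auto simp: f_def)
    have pM: "p \<in> M" using p S by auto
    then have pZ: "p \<in> int_vecs g" and tp: "t p < 1 / 2" by (auto simp: M_def)
    have "(real j)\<^sup>2 + 2 * real j * t p \<le> (real j)\<^sup>2 + 2 * real j * (1 / 2)"
      using tp by (intro add_left_mono mult_left_mono) auto
    also have "\<dots> = real (j * (j + 1))" by (simp add: power2_eq_square algebra_simps)
    \<comment> \<open>\<open>j < J\<close> gives \<open>j + 1\<close> \<le>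
      \<open>J\<close>.\<close>
    also have "\<dots> \<le> real (J * J)"
      using j by (intro of_nat_mono mult_mono) auto
    also have "\<dots> = (real J)\<^sup>2" by (simp add: power2_eq_square)
    finally have "q n \<le> q p + h w * (real J)\<^sup>2"
      using hw by (simp add: n q_shift[OF pZ])
    also have "\<dots> \<le> D + 2 * (real J)\<^sup>2 * h w" using S(3)[OF p] EJ by (simp add: mult_ac)
    finally show "n \<in> int_vecs g \<and> q n \<le> D + 2 * (real J)\<^sup>2 * h w"
      using shift_int[OF pZ] n by simp
  next
    fix u assume u: "u \<in> int_vecs g" "u \<noteq> 0\<^sub>v g"
    have "0 < (real J)\<^sup>2 * h w" using J1 hw by (intro mult_pos_pos) auto
    then have "2 * (real J)\<^sup>2 * h w < 4 * (real J)\<^sup>2 * h w" by (simp add: mult_ac)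
    also have "\<dots> \<le> 4 * (real J)\<^sup>2 * h u"
      using w_shortest[OF u] by (intro mult_left_mono) auto
    finally show "2 * (real J)\<^sup>2 * h w < (real (2 * J))\<^sup>2 * h u"
      by (simp add: power_mult_distrib)
  qed (simp add: J_def)
  then have "card S * J \<le> (4 * J) ^ g"
    by (simp add: card_image[OF inj] card_cartesian_product)
  also have "\<dots> = 4 ^ g * J ^ (g - 1) * J"
    using g_pos by (cases g) (auto simp: power_mult_distrib algebra_simps)
  finally have "0 < J \<longrightarrow> card S \<le> 4 ^ g * J ^ (g - 1)" by (simp only: mult_le_cancel2)
  then have "card S \<le> 4 ^ g * J ^ (g - 1)" using J1 by linarith
  then have "real (card S) \<le> real (4 ^ g * J ^ (g - 1))" by (rule of_nat_mono)
  also have "\<dots> = 4 ^ g * real J ^ (g - 1)" by simp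
  also have "\<dots> \<le> 4 ^ g * (sqrt E + 1) ^ (g - 1)"
    using J by (intro mult_left_mono power_mono) auto
  finally show ?thesis .
qed

text \<open>As \<open>p\<close> minimises \<open>q\<close> on its line, all exponents are at least
  \<open>max A (q p)\<close>. The two half-lines starting at \<open>p\<close> contribute at most 6
  times the leading exponential each.\<close>

lemma sum_line_le:
  assumes p: "p \<in> M" and F: "finite F" and R: "\<And>k. k \<in> F \<Longrightarrow> A \<le> q (shift p k)"
  shows "(\<Sum>k\<in>F. exp (- q (shift p k))) \<le> 12 * exp (- max A (q p))"
proof -
  have pZ: "p \<in> int_vecs g" and tp: "\<bar>t p\<bar> \<le> 1 / 2" using p by (auto simp: M_def)
  have ge: "max A (q p) \<le> q (shift p k)" if "k \<in> F" for k
  proof -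
    \<comment> \<open>For integral \<open>k\<close> the linear term is at most
      \<open>\<bar>k\<bar>\<close>, hence at most \<open>k^2\<close>: this is the minimality of
      \<open>p\<close>.\<close>
    have "\<bar>2 * of_int k * t p\<bar> \<le> \<bar>of_int k\<bar>"
      using mult_left_mono[OF tp, of "\<bar>of_int k\<bar> * 2"] by (simp add: abs_mult mult_ac)
    moreover have "\<bar>of_int k\<bar> \<le> (of_int k :: real)\<^sup>2"
    proof -
      have "\<bar>k\<bar> \<le> k\<^sup>2"
        using self_le_power[of "\<bar>k\<bar>" 2] by (cases "k = 0") auto
      then have "real_of_int \<bar>k\<bar> \<le> real_of_int (k\<^sup>2)" by (simp only: of_int_le_iff)
      then show ?thesis by simp
    qed
    ultimately have "0 \<le> (of_int k)\<^sup>2 + 2 * of_int k * t p" by linarith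
    then show ?thesis using R[OF that] hw q_shift[OF pZ, of k] by simp
  qed
  have side: "(\<Sum>i\<in>G. exp (- q (shift p (\<sigma> * int i)))) \<le> 6 * exp (- max A (q p))"
    if G: "finite G" "\<And>i. i \<in> G \<Longrightarrow> \<sigma> * int i \<in> F" and \<sigma>: "\<sigma> = 1 \<or> \<sigma> = - 1" for G \<sigma>
  proof (rule sum_exp_minus_le)
    fix i d :: nat
    have "q (shift p (\<sigma> * int (i + d))) - q (shift p (\<sigma> * int i))
      = h w * (real d * (real d + 2 * real i + 2 * of_int \<sigma> * t p))"
      using \<sigma> by (auto simp: q_shift[OF pZ] power2_eq_square algebra_simps)
    moreover have "real d - 1 \<le> h w * (real d * (real d + 2 * real i + 2 * of_int \<sigma> * t p))"
    proof (cases d)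
      case (Suc d')
      have "real d - 1 = 1 * (1 * (real d - 1))" by simp
      \<comment> \<open>Here \<open>d\<close> is at least 1 and \<open>2 * \<sigma> * t p\<close> is
        at least -1, so the last factor is at least \<open>d - 1\<close>. For \<open>d = 1\<close>,
        \<open>i = 0\<close> the growth may vanish, whence the defect.\<close>
      also have "\<dots> \<le> h w * (real d * (real d + 2 * real i + 2 * of_int \<sigma> * t p))"
        using hw Suc tp \<sigma> by (intro mult_mono mult_nonneg_nonneg) auto
      finally show ?thesis .
    qed simp
    ultimately show "q (shift p (\<sigma> * int i)) + real d - 1 \<le> q (shift p (\<sigma> * int (i + d)))"
      by linarith
  qed (use that ge in auto)
  define G where "G \<sigma> = {i. \<sigma> * int i \<in> F}" for \<sigma> :: int
  have fin: "finite (G \<sigma>)" if "\<sigma> = 1 \<or> \<sigma> = - 1" for \<sigma>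
    unfolding G_def using that F
    by (auto intro!: finite_vimageI[unfolded vimage_def] inj_onI injI)
  \<comment> \<open>The half-lines overlap in \<open>k = 0\<close>, which is harmless for an upper
    bound.\<close>
  have "F \<subseteq> (\<lambda>i. 1 * int i) ` G 1 \<union> (\<lambda>i. - 1 * int i) ` G (- 1)"
  proof
    fix k assume "k \<in> F"
    then show "k \<in> (\<lambda>i. 1 * int i) ` G 1 \<union> (\<lambda>i. - 1 * int i) ` G (- 1)"
      by (cases k rule: int_cases2) (auto simp: G_def image_iff)
  qed
  then have "(\<Sum>k\<in>F. exp (- q (shift p k)))
      \<le> (\<Sum>k\<in>(\<lambda>i. 1 * int i) ` G 1 \<union> (\<lambda>i. - 1 * int i) ` G (- 1). exp (- q (shift p k)))"
    using fin by (intro sum_mono2) auto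
  also have "\<dots> \<le> (\<Sum>k\<in>(\<lambda>i. 1 * int i) ` G 1. exp (- q (shift p k)))
      + (\<Sum>k\<in>(\<lambda>i. - 1 * int i) ` G (- 1). exp (- q (shift p k)))"
    using fin by (subst sum_Un) (auto intro!: sum_nonneg)
  also have "\<dots> \<le> 6 * exp (- max A (q p)) + 6 * exp (- max A (q p))"
  proof (rule add_mono)
    show "(\<Sum>k\<in>(\<lambda>i. 1 * int i) ` G 1. exp (- q (shift p k))) \<le> 6 * exp (- max A (q p))"
      using side[of "G 1" 1] fin[of 1] by (subst sum.reindex) (auto simp: G_def inj_on_def o_def)
    show "(\<Sum>k\<in>(\<lambda>i. - 1 * int i) ` G (- 1). exp (- q (shift p k))) \<le> 6 * exp (- max A (q p))"
      using side[of "G (- 1)" "- 1"] fin[of "- 1"]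
      by (subst sum.reindex) (auto simp: G_def inj_on_def o_def)
  qed
  finally show ?thesis by simp
qed

text \<open>The points are grouped by lines, and the lines by the integer layer \<kappa> of their
  minimum above \<open>A\<close>. Layer \<open>k\<close> contains polynomially many lines, each
  weighted by \<open>exp (- k)\<close>. The constant is 108 = 12 * 3 * 3: 12 per line, 3 for
  rounding to integer layers, 3 for the geometric series of ratio 2/3.\<close>

lemma sum_outside_le:
  assumes F: "finite F" "F \<subseteq> int_vecs g" "\<And>n. n \<in> F \<Longrightarrow> D + \<delta>\<^sup>2 \<le> q n" and \<delta>: "0 \<le> \<delta>"
  shows "(\<Sum>n\<in>F. exp (- q n)) \<le>
    108 * 4 ^ g * (2 * real (g - 1)) ^ (g - 1) * max 2 \<delta> ^ (g - 1) * exp (- (D + \<delta>\<^sup>2))"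
proof -
  define A where "A = D + \<delta>\<^sup>2"
  define H where "H = g - 1"
  define \<Delta> where "\<Delta> = max 2 \<delta>"
  define P where "P = line_min ` F"
  \<comment> \<open>All lines whose minimum is at most \<open>A\<close> fall into layer 0, through
    truncation by \<open>nat\<close>.\<close>
  define \<kappa> where "\<kappa> p = nat \<lceil>q p - A\<rceil>" for p
  have finP: "finite P" and PM: "P \<subseteq> M" using F line_min_M by (auto simp: P_def)
  have "(\<Sum>n\<in>F. exp (- q n)) = (\<Sum>p\<in>P. \<Sum>n\<in>{n \<in> F. line_min n = p}. exp (- q n))"
    unfolding P_def using F(1) by (rule sum.image_gen)
  also have "\<dots> \<le> (\<Sum>p\<in>P. 12 * exp (- max A (q p)))"
  proof (rule sum_mono)
    fix p assume p: "p \<in> P"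
    define X where "X = {n \<in> F. line_min n = p}"
    define k where "k n = \<lfloor>t n + 1 / 2\<rfloor>" for n
    have sh: "shift p (k n) = n" if "n \<in> X" for n
      using shift_line_min[of n] that F by (auto simp: X_def k_def)
    have inj: "inj_on k X" using sh by (metis inj_onI)
    have "(\<Sum>n\<in>X. exp (- q n)) = (\<Sum>n\<in>X. exp (- q (shift p (k n))))"
      using sh by simp
    also have "\<dots> = (\<Sum>j\<in>k ` X. exp (- q (shift p j)))"
      using inj by (simp add: sum.reindex)
    also have "\<dots> \<le> 12 * exp (- max A (q p))"
      by (rule sum_line_le) (use p PM F sh in \<open>auto simp: X_def A_def\<close>)
    finally show "(\<Sum>n\<in>{n \<in> F. line_min n = p}. exp (- q n)) \<le> 12 * exp (- max A (q p))"
      by (simp add: X_def)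
  qed
  also have "\<dots> \<le> (\<Sum>p\<in>P. 36 * exp (- A) * exp (- real (\<kappa> p)))"
  proof (rule sum_mono)
    fix p
    \<comment> \<open>Rounding up loses less than 1 in the exponent, a factor of at most
      \<open>exp 1\<close>.\<close>
    have "- max A (q p) \<le> 1 + (- A + - real (\<kappa> p))" unfolding \<kappa>_def by linarith
    then have "exp (- max A (q p)) \<le> exp 1 * (exp (- A) * exp (- real (\<kappa> p)))"
      by (simp flip: exp_add)
    also have "\<dots> \<le> 3 * (exp (- A) * exp (- real (\<kappa> p)))"
      using exp_le by (intro mult_right_mono) auto
    finally show "12 * exp (- max A (q p)) \<le> 36 * exp (- A) * exp (- real (\<kappa> p))" by simp
  qed
  also have "\<dots> = 36 * exp (- A) * (\<Sum>p\<in>P. exp (- real (\<kappa> p)))"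
    by (simp add: sum_distrib_left)
  also have "(\<Sum>p\<in>P. exp (- real (\<kappa> p)))
      = (\<Sum>k\<in>\<kappa> ` P. \<Sum>p\<in>{p \<in> P. \<kappa> p = k}. exp (- real (\<kappa> p)))"
    using finP by (rule sum.image_gen)
  also have "\<dots> \<le> (\<Sum>k\<in>\<kappa> ` P. 4 ^ g * (2 * real H) ^ H * \<Delta> ^ H * (2 / 3) ^ k)"
  proof (rule sum_mono)
    fix k
    have "real (card {p \<in> P. \<kappa> p = k}) \<le> 4 ^ g * (sqrt (\<delta>\<^sup>2 + real k) + 1) ^ (g - 1)"
    proof (rule card_lines_le)
      fix p assume "p \<in> {p \<in> P. \<kappa> p = k}"
      then have "q p - A \<le> real k" by (auto simp: \<kappa>_def) linarith
      then show "q p \<le> D + (\<delta>\<^sup>2 + real k)" by (simp add: A_def)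
    qed (use finP PM in auto)
    also have "\<dots> \<le> 4 ^ g * ((real k + 2) * \<Delta>) ^ H"
      unfolding H_def
    proof (intro mult_left_mono power_mono)
      have "sqrt (\<delta>\<^sup>2 + real k) \<le> \<delta> + sqrt (real k)"
        using sqrt_add_le_add_sqrt[of "\<delta>\<^sup>2" "real k"] \<delta> by simp
      moreover have "real k \<le> (real k)\<^sup>2" by (cases k) (auto simp: power2_eq_square)
      then have "sqrt (real k) \<le> real k" by (intro real_le_lsqrt) auto
      moreover have "real k * 1 \<le> real k * \<Delta>" by (intro mult_left_mono) (auto simp: \<Delta>_def)
      moreover have "\<delta> \<le> \<Delta>" "1 \<le> \<Delta>" by (auto simp: \<Delta>_def)
      ultimately show "sqrt (\<delta>\<^sup>2 + real k) + 1 \<le> (real k + 2) * \<Delta>"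
        by (simp add: algebra_simps)
    qed auto
    also have "\<dots> = 4 ^ g * ((real k + 2) ^ H * \<Delta> ^ H)" by (simp add: power_mult_distrib)
    also have "\<dots> \<le> 4 ^ g * (((2 * real H) ^ H * exp (real k / 2)) * \<Delta> ^ H)"
    proof (intro mult_left_mono mult_right_mono)
      \<comment> \<open>Half of the decay \<open>exp (- k)\<close> absorbs the polynomial:
        \<open>1 + x\<close> \<le> \<open>exp x\<close> at \<open>x = k / (2 * H)\<close>, raised to
        the power \<open>H\<close>. For \<open>H = 0\<close> both \<open>0 ^ 0\<close> and the
        left-hand side are 1.\<close>
      show "(real k + 2) ^ H \<le> (2 * real H) ^ H * exp (real k / 2)"
      proof (cases "H = 0")
        case False
        have "real k + 2 \<le> 2 * real H * (1 + real k / (2 * real H))"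
          using False by (simp add: field_simps)
        also have "\<dots> \<le> 2 * real H * exp (real k / (2 * real H))"
          by (intro mult_left_mono exp_ge_add_one_self) auto
        finally have "(real k + 2) ^ H \<le> (2 * real H * exp (real k / (2 * real H))) ^ H"
          by (intro power_mono) auto
        also have "\<dots> = (2 * real H) ^ H * exp (real k / 2)"
          using False by (simp add: power_mult_distrib flip: exp_of_nat_mult)
        finally show ?thesis .
      qed simp
    qed (auto simp: \<Delta>_def)
    finally have card: "real (card {p \<in> P. \<kappa> p = k})
      \<le> 4 ^ g * (2 * real H) ^ H * \<Delta> ^ H * exp (real k / 2)" by (simp add: mult_ac)
    have e: "exp (- 1 / 2 :: real) \<le> 2 / 3"
      using exp_ge_add_one_self[of "1 / 2"] by (simp add: exp_minus field_simps)
    have "(\<Sum>p\<in>{p \<in> P. \<kappa> p = k}. exp (- real (\<kappa> p))) = real (card {p \<in> P. \<kappa> p = k}) * exp (- real k)"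
      by simp
    also have "\<dots> \<le> 4 ^ g * (2 * real H) ^ H * \<Delta> ^ H * exp (real k / 2) * exp (- real k)"
      using card by (intro mult_right_mono) auto
    also have "\<dots> = 4 ^ g * (2 * real H) ^ H * \<Delta> ^ H * exp (- 1 / 2) ^ k"
      by (simp add: mult.assoc flip: exp_add exp_of_nat_mult)
    also have "\<dots> \<le> 4 ^ g * (2 * real H) ^ H * \<Delta> ^ H * (2 / 3) ^ k"
      using e by (intro mult_left_mono power_mono) (auto simp: \<Delta>_def)
    finally show "(\<Sum>p\<in>{p \<in> P. \<kappa> p = k}. exp (- real (\<kappa> p)))
      \<le> 4 ^ g * (2 * real H) ^ H * \<Delta> ^ H * (2 / 3) ^ k" .
  qed
  also have "\<dots> = 4 ^ g * (2 * real H) ^ H * \<Delta> ^ H * (\<Sum>k\<in>\<kappa> ` P. (2 / 3) ^ k)"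
    by (simp add: sum_distrib_left)
  also have "\<dots> \<le> 4 ^ g * (2 * real H) ^ H * \<Delta> ^ H * 3"
    using sum_geometric_le[of "\<kappa> ` P" "2 / 3"] finP
    by (intro mult_left_mono) (auto simp: \<Delta>_def)
  finally show ?thesis by (simp add: A_def H_def \<Delta>_def mult_ac)
qed

end

section \<open>Comparison with the explicit constant\<close>

text \<open>The factor \<open>2 ^ (g - 1)\<close> is \<open>max 2 \<delta> ^ (g - 1)\<close> at
  \<delta> = 0, which the theta bound must absorb as well. The factor 108 goes into
  \<open>2 ^ 10\<close>; the rest is at most \<open>(16 * g) ^ g\<close>, hence at most
  \<open>g ^ (5 * g)\<close> for \<open>g\<close> at least 2. The case \<open>g = 1\<close> reads
  432 \<le> 1024.\<close>

lemma B_bound_ge: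
  assumes "1 \<le> g"
  shows "108 * 4 ^ g * (2 * real (g - 1)) ^ (g - 1) * 2 ^ (g - 1) \<le> B_bound g"
proof (cases "g = 1")
  case True
  then show ?thesis by (simp add: B_bound_def)
next
  case False
  then have g2: "2 \<le> g" using assms by simp
  \<comment> \<open>The bound \<open>B_bound\<close> has base 2 but a natural logarithm in its
    exponent; \<open>ln 2\<close> \<ge> 1/2 turns the exponent 10 into at least 5.\<close>
  have "ln (1 / 2 :: real) \<le> 1 / 2 - 1" by (rule ln_le_minus_one) simp
  then have ln2: "1 / 2 \<le> ln (2::real)" by (simp add: ln_div)
  have "(2 * real (g - 1)) ^ (g - 1) * 2 ^ (g - 1) = (4 * real (g - 1)) ^ (g - 1)"
    by (subst power_mult_distrib[symmetric]) simp
  then have "108 * 4 ^ g * (2 * real (g - 1)) ^ (g - 1) * 2 ^ (g - 1)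
      = 108 * 4 ^ g * (4 * real (g - 1)) ^ (g - 1)"
    by (simp only: mult.assoc)
  also have "\<dots> \<le> 1024 * 4 ^ g * (4 * real g) ^ g"
  proof (intro mult_mono)
    have "(4 * real (g - 1)) ^ (g - 1) \<le> (4 * real g) ^ (g - 1)" by (intro power_mono) auto
    also have "\<dots> \<le> (4 * real g) ^ g" using g2 by (intro power_increasing) auto
    finally show "(4 * real (g - 1)) ^ (g - 1) \<le> (4 * real g) ^ g" .
  qed auto
  also have "\<dots> = 1024 * (4 * (4 * real g)) ^ g"
    by (simp only: power_mult_distrib[of 4 "4 * real g"] mult.assoc)
  also have "\<dots> = 1024 * (2 ^ 4 * real g) ^ g" by simp
  also have "\<dots> \<le> 1024 * (real g ^ 5) ^ g"
  proof (intro mult_left_mono power_mono)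
    have "(2::real) ^ 4 * real g \<le> real g ^ 4 * real g"
      using g2 by (intro mult_right_mono power_mono) auto
    then show "(2::real) ^ 4 * real g \<le> real g ^ 5" by (simp add: eval_nat_numeral mult_ac)
  qed auto
  also have "\<dots> = 1024 * exp (5 * real g * ln (real g))"
  proof -
    have "exp (real (5 * g) * ln (real g)) = exp (ln (real g)) ^ (5 * g)"
      by (rule exp_of_nat_mult)
    also have "\<dots> = (real g ^ 5) ^ g" using g2 by (simp add: power_mult)
    finally show ?thesis by simp
  qed
  also have "\<dots> \<le> 1024 * exp (10 * real g * ln (real g) * ln 2)"
  proof (intro mult_left_mono, subst exp_le_cancel_iff)
    have "5 * real g * ln (real g) = 10 * real g * ln (real g) * (1 / 2)" by simp
    also have "\<dots> \<le> 10 * real g * ln (real g) * ln 2"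
      using g2 ln2 by (intro mult_left_mono) auto
    finally show "5 * real g * ln (real g) \<le> 10 * real g * ln (real g) * ln 2" .
  qed auto
  also have "exp (10 * real g * ln (real g) * ln 2) = 2 powr (10 * (real g * ln (real g)))"
    by (simp add: powr_def mult_ac)
  also have "1024 * 2 powr (10 * (real g * ln (real g))) = B_bound g"
    by (simp add: B_bound_def powr_add distrib_left)
  finally show ?thesis .
qed

section \<open>The quadratic form and the distance attached to \<tau>\<close>

lemma siegel_Im:
  assumes "\<tau> \<in> siegel g"
  shows "Im_mat \<tau> \<in> carrier_mat g g" "(Im_mat \<tau>)\<^sup>T = Im_mat \<tau>" "pos_def (Im_mat \<tau>)"
proof -
  have c: "\<tau> \<in> carrier_mat g g" and sym: "\<tau>\<^sup>T = \<tau>" using assms by (auto simp: siegel_def)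
  show "Im_mat \<tau> \<in> carrier_mat g g" using c by (simp add: Im_mat_def)
  have "(map_mat Im \<tau>)\<^sup>T = map_mat Im (\<tau>\<^sup>T)" by (rule eq_matI) auto
  then show "(Im_mat \<tau>)\<^sup>T = Im_mat \<tau>" by (simp add: Im_mat_def sym)
  show "pos_def (Im_mat \<tau>)" using assms by (simp add: siegel_def)
qed

lemma norm_tau_sq:
  assumes "\<tau> \<in> siegel g" "x \<in> carrier_vec g"
  shows "(norm_tau \<tau> x)\<^sup>2 = pi * (x \<bullet> (Im_mat \<tau> *\<^sub>v x))"
proof -
  have "0 \<le> x \<bullet> (Im_mat \<tau> *\<^sub>v x)"
    using siegel_Im[OF assms(1)] assms(2)
    by (cases "x = 0\<^sub>v g") (auto simp: pos_def_def intro: less_imp_le)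
  then show ?thesis by (simp add: norm_tau_def)
qed

text \<open>A positive definite matrix has trivial kernel, so \<open>mat_inverse\<close> returns
  \<open>Some\<close> and \<open>the\<close> is applied to a genuine value.\<close>

lemma inv_mat_right:
  assumes Y: "Y \<in> carrier_mat g g" and pd: "pos_def Y"
  shows "inv_mat Y \<in> carrier_mat g g" "Y * inv_mat Y = 1\<^sub>m g"
proof -
  have "det Y \<noteq> 0"
  proof
    assume "det Y = 0"
    then obtain v where "v \<in> carrier_vec g" "v \<noteq> 0\<^sub>v g" "Y *\<^sub>v v = 0\<^sub>v g"
      using det_0_iff_vec_prod_zero_field[OF Y] by blast
    with pd Y show False by (auto simp: pos_def_def)
  qed
  then have "Y \<in> Units (ring_mat TYPE(real) g ())" by (rule det_non_zero_imp_unit[OF Y])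
  then obtain B where B: "mat_inverse Y = Some B"
    using mat_inverse(1)[OF Y, of "()"] by (cases "mat_inverse Y") auto
  then show "inv_mat Y \<in> carrier_mat g g" "Y * inv_mat Y = 1\<^sub>m g"
    using mat_inverse(2)[OF Y B] by (auto simp: inv_mat_def)
qed

lemma quadratic_form_diff:
  fixes Y :: "real mat"
  assumes Y: "Y \<in> carrier_mat g g" and x: "x \<in> carrier_vec g" "y \<in> carrier_vec g"
  shows "(x - y) \<bullet> (Y *\<^sub>v (x - y)) =
    x \<bullet> (Y *\<^sub>v x) - x \<bullet> (Y *\<^sub>v y) - y \<bullet> (Y *\<^sub>v x) + y \<bullet> (Y *\<^sub>v y)"
proof -
  have [simp]: "Y *\<^sub>v u \<in> carrier_vec g" if "u \<in> carrier_vec g" for u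
    using Y that by simp
  show ?thesis
    using x by (simp add: mult_minus_distrib_mat_vec[OF Y] minus_scalar_prod_distrib[of _ g]
        scalar_prod_minus_distrib[of _ g])
qed

lemma quadratic_form_add_smult:
  fixes Y :: "real mat"
  assumes Y: "Y \<in> carrier_mat g g" and x: "x \<in> carrier_vec g" "y \<in> carrier_vec g"
  shows "(x + k \<cdot>\<^sub>v y) \<bullet> (Y *\<^sub>v (x + k \<cdot>\<^sub>v y)) =
    x \<bullet> (Y *\<^sub>v x) + k * (x \<bullet> (Y *\<^sub>v y) + y \<bullet> (Y *\<^sub>v x)) + k\<^sup>2 * (y \<bullet> (Y *\<^sub>v y))"
proof -
  have [simp]: "Y *\<^sub>v u \<in> carrier_vec g" if "u \<in> carrier_vec g" for u
    using Y that by simp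
  show ?thesis
    using x by (simp add: mult_add_distrib_mat_vec[OF Y] mult_mat_vec[OF Y]
        add_scalar_prod_distrib[of _ g] scalar_prod_add_distrib[of _ g] power2_eq_square
        distrib_left)
qed

lemma norm_tau_minus_commute:
  assumes "\<tau> \<in> siegel g" "x \<in> carrier_vec g" "y \<in> carrier_vec g"
  shows "norm_tau \<tau> (x - y) = norm_tau \<tau> (y - x)"
  using siegel_Im(1)[OF assms(1)] assms(2,3)
  by (simp add: norm_tau_def quadratic_form_diff[of _ g] add_ac)

text \<open>The infimum is over a nonempty set bounded below by 0, hence a true lower bound. The
  sign change passes from \<open>v - x\<close> in \<open>Dist_tau\<close> to \<open>n - v\<close> in
  the sums.\<close>

lemma Dist_tau_sq_le:
  assumes "\<tau> \<in> siegel g" "v \<in> carrier_vec g" "S \<subseteq> carrier_vec g" "n \<in> S"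
  shows "0 \<le> Dist_tau \<tau> v S" "(Dist_tau \<tau> v S)\<^sup>2 \<le> (norm_tau \<tau> (n - v))\<^sup>2"
proof -
  have nn: "0 \<le> norm_tau \<tau> (v - x)" if "x \<in> carrier_vec g" for x
  proof -
    have "0 \<le> (norm_tau \<tau> (v - x))\<^sup>2" by simp
    then have "0 \<le> pi * ((v - x) \<bullet> (Im_mat \<tau> *\<^sub>v (v - x)))"
      using norm_tau_sq[OF assms(1), of "v - x"] that assms(2) by simp
    then show ?thesis by (simp add: norm_tau_def)
  qed
  show D: "0 \<le> Dist_tau \<tau> v S"
    unfolding Dist_tau_def using assms nn by (intro cINF_greatest) auto
  have "Dist_tau \<tau> v S \<le> norm_tau \<tau> (v - n)"
    unfolding Dist_tau_def using assms nn by (intro cINF_lower bdd_belowI2[of _ 0]) auto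
  also have "\<dots> = norm_tau \<tau> (n - v)"
    using assms by (intro norm_tau_minus_commute) auto
  finally show "(Dist_tau \<tau> v S)\<^sup>2 \<le> (norm_tau \<tau> (n - v))\<^sup>2"
    using D by (intro power_mono) auto
qed

text \<open>Instantiates the abstract estimate. \<open>D\<close> is any lower bound for the squared
  distances, so that the lemma also serves a translated lattice. \<open>C\<close> is kept instead of
  \<open>B_bound\<close> because the theta bound needs room for \<open>2 ^ (g - 1)\<close>.\<close>

lemma exp_sum_outside_le:
  assumes g: "1 \<le> g" and \<tau>: "\<tau> \<in> siegel g" and red: "reduced g \<tau>" and v: "v \<in> carrier_vec g"
    and D: "\<And>n. n \<in> int_vecs g \<Longrightarrow> D \<le> (norm_tau \<tau> (n - v))\<^sup>2" and \<delta>: "0 \<le> \<delta>"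
    and S: "S \<subseteq> int_vecs g" "\<And>n. n \<in> S \<Longrightarrow> D + \<delta>\<^sup>2 \<le> (norm_tau \<tau> (n - v))\<^sup>2"
  defines "C \<equiv> 108 * 4 ^ g * (2 * real (g - 1)) ^ (g - 1)"
  shows "(\<lambda>n. exp (- (norm_tau \<tau> (n - v))\<^sup>2)) summable_on S"
    "(\<Sum>\<^sub>\<infinity>n\<in>S. exp (- (norm_tau \<tau> (n - v))\<^sup>2)) \<le> C * max 2 \<delta> ^ (g - 1) * exp (- (D + \<delta>\<^sup>2))"
proof -
  note Y = siegel_Im[OF \<tau>]
  define q where "q n = (norm_tau \<tau> (n - v))\<^sup>2" for n
  define h where "h w = pi * (w \<bullet> (Im_mat \<tau> *\<^sub>v w))" for w
  define \<beta> where "\<beta> n w = pi * ((n - v) \<bullet> (Im_mat \<tau> *\<^sub>v w) + w \<bullet> (Im_mat \<tau> *\<^sub>v (n - v)))" for n w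
  interpret lattice_quadratic g q h \<beta> D
  proof
    fix n w :: "real vec" and k :: int assume nw: "n \<in> int_vecs g" "w \<in> int_vecs g"
    then have c: "n \<in> carrier_vec g" "w \<in> carrier_vec g" by (auto simp: int_vecs_def)
    have eq: "n + of_int k \<cdot>\<^sub>v w - v = (n - v) + of_int k \<cdot>\<^sub>v w"
      using c v by (intro eq_vecI) auto
    show "q (n + of_int k \<cdot>\<^sub>v w) = q n + of_int k * \<beta> n w + (of_int k)\<^sup>2 * h w"
      using c v
      by (simp add: q_def h_def \<beta>_def norm_tau_sq[OF \<tau>] eq quadratic_form_add_smult[OF Y(1)]
          algebra_simps)
  next
    fix w assume w: "w \<in> int_vecs g" "w \<noteq> 0\<^sub>v g"
    \<comment> \<open>The minimum \<open>sqrt 3 / 2\<close> of a reduced matrix enters here: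
      multiplied by \<pi> it exceeds 1.\<close>
    have "1 \<le> 2 * (sqrt 3 / 2)" by simp
    also have "\<dots> \<le> pi * (w \<bullet> (Im_mat \<tau> *\<^sub>v w))"
      using red w by (intro mult_mono pi_ge_two) (auto simp: reduced_def)
    finally show "1 \<le> h w" by (simp add: h_def)
  qed (use g D in \<open>auto simp: q_def\<close>)
  obtain w where w: "w \<in> int_vecs g" "w \<noteq> 0\<^sub>v g"
    "\<And>u. u \<in> int_vecs g \<Longrightarrow> u \<noteq> 0\<^sub>v g \<Longrightarrow> h w \<le> h u"
    using obtain_shortest by blast
  interpret lattice_lines g q h \<beta> D w by unfold_locales (use w in auto)
  have bound: "(\<Sum>n\<in>F. exp (- (norm_tau \<tau> (n - v))\<^sup>2))
      \<le> C * max 2 \<delta> ^ (g - 1) * exp (- (D + \<delta>\<^sup>2))" if "finite F" "F \<subseteq> S" for F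
    using sum_outside_le[of F \<delta>] that S \<delta> by (auto simp: q_def C_def)
  show sm: "(\<lambda>n. exp (- (norm_tau \<tau> (n - v))\<^sup>2)) summable_on S"
    by (rule nonneg_bounded_partial_sums_imp_summable_on)
      (auto intro!: bound eventually_finite_subsets_at_top_weakI)
  show "(\<Sum>\<^sub>\<infinity>n\<in>S. exp (- (norm_tau \<tau> (n - v))\<^sup>2)) \<le> C * max 2 \<delta> ^ (g - 1) * exp (- (D + \<delta>\<^sup>2))"
    by (rule infsum_le_finite_sums[OF sm bound])
qed

section \<open>Absolute values of the terms of the theta series\<close>

lemma Im_of_real_scalar_prod:
  assumes "dim_vec n = dim_vec u"
  shows "Im (map_vec complex_of_real n \<bullet> u) = n \<bullet> map_vec Im u"
  using assms by (simp add: scalar_prod_def)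

lemma Im_mult_mat_of_real_vec:
  assumes "A \<in> carrier_mat g g" "n \<in> carrier_vec g"
  shows "map_vec Im (A *\<^sub>v map_vec complex_of_real n) = Im_mat A *\<^sub>v n"
  using assms by (intro eq_vecI) (auto simp: scalar_prod_def Im_mat_def intro!: sum.cong)

text \<open>Completing the square: the modulus depends on
  \<open>Im X = n \<bullet> Y n + 2 * (n \<bullet> y)\<close>, and the exponential prefactor
  supplies the missing constant \<open>y \<bullet> inv_mat Y y\<close>. The characteristic
  \<open>b\<close> is real and only changes the phase.\<close>

lemma cmod_theta_term:
  assumes \<tau>: "\<tau> \<in> siegel g" and z: "z \<in> carrier_vec g" and b: "b \<in> carrier_vec g"
    and n: "n \<in> carrier_vec g"
  defines "y \<equiv> map_vec Im z" and "n' \<equiv> map_vec complex_of_real n"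
  defines "v \<equiv> - (inv_mat (Im_mat \<tau>) *\<^sub>v y)"
  shows "exp (- pi * (y \<bullet> (inv_mat (Im_mat \<tau>) *\<^sub>v y))) *
      cmod (e_pi (n' \<bullet> (\<tau> *\<^sub>v n') + 2 * (n' \<bullet> (z + (1/2) \<cdot>\<^sub>v map_vec complex_of_real b))))
    = exp (- (norm_tau \<tau> (n - v))\<^sup>2)"
proof -
  define Y where "Y = Im_mat \<tau>"
  note Y = siegel_Im[OF \<tau>, folded Y_def]
  note inv = inv_mat_right[OF Y(1,3)]
  have \<tau>c: "\<tau> \<in> carrier_mat g g" using \<tau> by (simp add: siegel_def)
  have y: "y \<in> carrier_vec g" using z by (simp add: y_def)
  define u where "u = inv_mat Y *\<^sub>v y"
  have u: "u \<in> carrier_vec g" using inv y by (simp add: u_def)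
  have vu: "v = - u" and v: "v \<in> carrier_vec g" using u by (auto simp: v_def u_def Y_def)
  have "Y *\<^sub>v u = (Y * inv_mat Y) *\<^sub>v y"
    unfolding u_def using Y(1) inv(1) y by (simp add: assoc_mult_mat_vec)
  then have Yu: "Y *\<^sub>v u = y" using inv(2) y by simp
  have Yv: "Y *\<^sub>v v = - y"
  proof -
    have "v = (- 1) \<cdot>\<^sub>v u" using u by (auto simp: vu)
    then have "Y *\<^sub>v v = (- 1) \<cdot>\<^sub>v y" using mult_mat_vec[OF Y(1) u, of "- 1"] Yu by simp
    then show ?thesis by auto
  qed
  \<comment> \<open>Symmetry of \<open>Y\<close> merges the two cross terms.\<close>
  have "v \<bullet> (Y *\<^sub>v n) = n \<bullet> (Y *\<^sub>v v)"
    using transpose_vec_mult_scalar[OF Y(1) n v] Y v n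
    by (simp add: comm_scalar_prod[of n g])
  then have "(n - v) \<bullet> (Y *\<^sub>v (n - v)) = n \<bullet> (Y *\<^sub>v n) + 2 * (n \<bullet> y) + y \<bullet> u"
    unfolding quadratic_form_diff[OF Y(1) n v]
    using y n u by (simp add: Yv) (simp add: vu comm_scalar_prod[of u g])
  then have q: "(norm_tau \<tau> (n - v))\<^sup>2 = pi * (n \<bullet> (Y *\<^sub>v n) + 2 * (n \<bullet> y) + y \<bullet> u)"
    using n v by (simp add: norm_tau_sq[OF \<tau>] Y_def)
  have Imz: "map_vec Im (z + (1/2) \<cdot>\<^sub>v map_vec complex_of_real b) = y"
    using z b by (intro eq_vecI) (auto simp: y_def)
  define X where
    "X = n' \<bullet> (\<tau> *\<^sub>v n') + 2 * (n' \<bullet> (z + (1/2) \<cdot>\<^sub>v map_vec complex_of_real b))"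
  have ImX: "Im X = n \<bullet> (Y *\<^sub>v n) + 2 * (n \<bullet> y)"
    unfolding X_def n'_def using n z b \<tau>c
    by (simp add: Im_of_real_scalar_prod Im_mult_mat_of_real_vec[of _ g] Imz Y_def)
  have "cmod (e_pi X) = exp (- pi * Im X)" by (simp add: e_pi_def norm_exp_eq_Re)
  then show ?thesis
    unfolding X_def[symmetric] q
    by (simp add: ImX u_def Y_def algebra_simps flip: exp_add)
qed

section \<open>Lattice sums outside an ellipsoid and the bound for theta functions\<close>

theorem theorem3p6:
  fixes g :: nat
  assumes "g \<ge> 1"
    and "\<tau> \<in> siegel g"
    and "reduced g \<tau>"
  shows "(\<forall>v \<in> carrier_vec g. \<forall>R \<delta> :: real.
            R \<ge> 0 \<and> \<delta> \<ge> 0 \<and> R ^ 2 = Dist_tau \<tau> v (int_vecs g) ^ 2 + \<delta> ^ 2 \<longrightarrow>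
            (\<lambda>n. exp (- (norm_tau \<tau> (n - v) ^ 2))) summable_on (int_vecs g - ellipsoid v R \<tau>) \<and>
            (\<Sum>\<^sub>\<infinity>n \<in> int_vecs g - ellipsoid v R \<tau>. exp (- (norm_tau \<tau> (n - v) ^ 2)))
              \<le> B_bound g * max 2 \<delta> ^ (g - 1) * exp (- (R ^ 2)))
       \<and> (\<forall>z \<in> carrier_vec g. \<forall>a \<in> zero_one_vecs g. \<forall>b \<in> zero_one_vecs g.
            let v = - (inv_mat (Im_mat \<tau>) *\<^sub>v map_vec Im z) in
            cmod (theta_tilde a b z \<tau>)
              \<le> B_bound g * exp (- (Dist_tau \<tau> v (half_translate a) ^ 2)))"
proof (intro conjI ballI allI impI; (elim conjE)?)
  define C where "C = 108 * 4 ^ g * (2 * real (g - 1)) ^ (g - 1)"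
  have C: "C * 2 ^ (g - 1) \<le> B_bound g" using B_bound_ge[OF assms(1)] by (simp add: C_def)
  have ZC: "int_vecs g \<subseteq> carrier_vec g" by (auto simp: int_vecs_def)
  {
    fix v and R \<delta> :: real
    assume v: "v \<in> carrier_vec g" and R: "0 \<le> R" and \<delta>: "0 \<le> \<delta>"
      and R2: "R\<^sup>2 = (Dist_tau \<tau> v (int_vecs g))\<^sup>2 + \<delta>\<^sup>2"
    have S: "(Dist_tau \<tau> v (int_vecs g))\<^sup>2 + \<delta>\<^sup>2 \<le> (norm_tau \<tau> (n - v))\<^sup>2"
      if "n \<in> int_vecs g - ellipsoid v R \<tau>" for n
    proof -
      have "R \<le> norm_tau \<tau> (n - v)"
        using that ZC assms(2) by (auto simp: ellipsoid_def siegel_def)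
      then have "R\<^sup>2 \<le> (norm_tau \<tau> (n - v))\<^sup>2" using R by (intro power_mono)
      then show ?thesis by (simp add: R2)
    qed
    note main = exp_sum_outside_le[OF assms v Dist_tau_sq_le(2)[OF assms(2) v ZC] \<delta> Diff_subset S,
        folded R2 C_def]
    show "(\<lambda>n. exp (- (norm_tau \<tau> (n - v) ^ 2))) summable_on (int_vecs g - ellipsoid v R \<tau>)"
      by (rule main(1))
    \<comment> \<open>The spare factor \<open>2 ^ (g - 1)\<close> is not wanted here, as
      \<open>max 2 \<delta>\<close> stays in the bound.\<close>
    have "C * 1 \<le> C * 2 ^ (g - 1)" by (intro mult_left_mono) (auto simp: C_def)
    then have "C \<le> B_bound g" using C by linarith
    then have "C * max 2 \<delta> ^ (g - 1) * exp (- R\<^sup>2) \<le> B_bound g * max 2 \<delta> ^ (g - 1) * exp (- R\<^sup>2)"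
      by (intro mult_right_mono) auto
    with main(2) show "(\<Sum>\<^sub>\<infinity>n \<in> int_vecs g - ellipsoid v R \<tau>. exp (- (norm_tau \<tau> (n - v) ^ 2)))
              \<le> B_bound g * max 2 \<delta> ^ (g - 1) * exp (- (R ^ 2))"
      by (rule order_trans)
  }
  fix z :: "complex vec" and a b :: "real vec"
  assume z: "z \<in> carrier_vec g" and a: "a \<in> zero_one_vecs g" and b: "b \<in> zero_one_vecs g"
  define y where "y = map_vec Im z"
  define v where "v = - (inv_mat (Im_mat \<tau>) *\<^sub>v y)"
  define D where "D = (Dist_tau \<tau> v (half_translate a))\<^sup>2"
  have ac: "a \<in> carrier_vec g" and bc: "b \<in> carrier_vec g"
    using a b by (auto simp: zero_one_vecs_def)
  have yc: "y \<in> carrier_vec g" using z by (simp add: y_def)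
  have vc: "v \<in> carrier_vec g"
    using inv_mat_right(1)[OF siegel_Im(1,3)[OF assms(2)]] yc by (simp add: v_def)
  define tr where "tr n = n + (1/2) \<cdot>\<^sub>v a" for n
  have H: "half_translate a = tr ` int_vecs g"
    using ac by (auto simp: half_translate_def tr_def)
  have inj: "inj_on tr (int_vecs g)"
    by (rule inj_on_inverseI[where g = "\<lambda>x. x - (1/2) \<cdot>\<^sub>v a"])
      (use ac in \<open>auto simp: tr_def int_vecs_def\<close>)
  have HC: "half_translate a \<subseteq> carrier_vec g"
    using ac ZC by (auto simp: H tr_def)
  \<comment> \<open>Translating the lattice by \<open>a / 2\<close> amounts to translating
    \<open>v\<close> by \<open>- a / 2\<close>, which brings the sum back to integer
    vectors.\<close>
  have shift: "tr n - v = n - (v - (1/2) \<cdot>\<^sub>v a)" if "n \<in> int_vecs g" for n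
    using that ac vc by (intro eq_vecI) (auto simp: tr_def int_vecs_def)
  define E where "E n = exp (- (norm_tau \<tau> (n - v))\<^sup>2)" for n
  define T where "T n = (let n' = map_vec complex_of_real n; b' = map_vec complex_of_real b in
     e_pi (n' \<bullet> (\<tau> *\<^sub>v n') + 2 * (n' \<bullet> (z + (1/2) \<cdot>\<^sub>v b'))))" for n
  define K where "K = exp (- pi * (y \<bullet> (inv_mat (Im_mat \<tau>) *\<^sub>v y)))"
  have KT: "K * cmod (T n) = E n" if "n \<in> half_translate a" for n
    using cmod_theta_term[OF assms(2) z bc, of n] that HC
    by (auto simp: K_def T_def E_def Let_def y_def v_def)
  have D: "D \<le> (norm_tau \<tau> (n - (v - (1/2) \<cdot>\<^sub>v a)))\<^sup>2" if "n \<in> int_vecs g" for n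
    using Dist_tau_sq_le(2)[OF assms(2) vc HC, of "tr n"] that by (simp add: H D_def shift)
  have vac: "v - (1/2) \<cdot>\<^sub>v a \<in> carrier_vec g" using vc ac by simp
  have Ecomp: "(E \<circ> tr) n = exp (- (norm_tau \<tau> (n - (v - (1/2) \<cdot>\<^sub>v a)))\<^sup>2)"
    if "n \<in> int_vecs g" for n
    using that by (simp add: E_def shift)
  \<comment> \<open>With \<delta> = 0 no lattice point is excluded, and the estimate covers the full
    series.\<close>
  have D0: "D + 0\<^sup>2 \<le> (norm_tau \<tau> (n - (v - (1/2) \<cdot>\<^sub>v a)))\<^sup>2" if "n \<in> int_vecs g" for n
    using D[OF that] by simp
  note main = exp_sum_outside_le[OF assms vac D order_refl order_refl D0, folded C_def]
  have sE: "E summable_on half_translate a"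
    unfolding H summable_on_reindex[OF inj]
    by (rule summable_on_cong[THEN iffD2, OF _ main(1)]) (rule Ecomp)
  have "infsum E (half_translate a) = infsum (E \<circ> tr) (int_vecs g)"
    unfolding H using inj by (rule infsum_reindex)
  also have "\<dots> = (\<Sum>\<^sub>\<infinity>n\<in>int_vecs g. exp (- (norm_tau \<tau> (n - (v - (1/2) \<cdot>\<^sub>v a)))\<^sup>2))"
    by (rule infsum_cong) (rule Ecomp)
  also have "\<dots> \<le> C * 2 ^ (g - 1) * exp (- D)"
    using main(2) by simp
  also have "\<dots> \<le> B_bound g * exp (- D)"
    using C by (intro mult_right_mono) auto
  finally have bE: "infsum E (half_translate a) \<le> B_bound g * exp (- D)" .
  have nT: "norm (of_real K * T n) = E n" if "n \<in> half_translate a" for n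
    using KT[OF that] by (simp add: norm_mult K_def)
  have "cmod (theta_tilde a b z \<tau>) = cmod (\<Sum>\<^sub>\<infinity>n\<in>half_translate a. of_real K * T n)"
    by (simp add: theta_tilde_def theta_def Let_def T_def K_def y_def infsum_cmult_right')
  \<comment> \<open>Triangle inequality; the absolute summability comes from
    \<open>sE\<close>.\<close>
  also have "\<dots> \<le> (\<Sum>\<^sub>\<infinity>n\<in>half_translate a. norm (of_real K * T n))"
    using sE by (intro norm_infsum_bound) (simp add: summable_on_cong[OF nT])
  also have "\<dots> = infsum E (half_translate a)"
    by (rule infsum_cong) (rule nT)
  finally show "let v = - (inv_mat (Im_mat \<tau>) *\<^sub>v map_vec Im z) in
            cmod (theta_tilde a b z \<tau>)
              \<le> B_bound g * exp (- (Dist_tau \<tau> v (half_translate a) ^ 2))"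
    using bE by (simp add: Let_def D_def v_def y_def)
qed

end
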